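(* Let $S$ be a non-empty $\omega$-closed set of infinite cardinals such that $\min S=\kappa$ and $\sup S\le 2^{2^{\kappa}}$. Then there is a crowded Hausdorff space $X$ with $S=dd(X)$.
   Context: A space is crowded if it has no isolated points. The density $d(X)$ of a space $X$ is the minimum cardinality of a dense subspace of $X$. $\mathcal{D}(X)$ denotes the family of all dense subspaces of $X$, and $dd(X)=\{d(D): D\in\mathcal{D}(X)\}$ is the double density spectrum of $X$. A set of cardinals is $\omega$-closed if it contains the supremum of each of its non-empty countable subsets. *)

theory Defs
  imports "HOL-Analysis.Analysis"
begin

no_notation Set_Algebras.elt_set_eq (infix "=o" 50)
unbundle cardinal_syntax

text \<open>
  Cardinals are represented by the initial well-orders of the library
  (\<^const>\<open>Card_order\<close>), compared by \<open>\<le>o\<close> and identified up to \<open>=o\<close>.  A set of cardinals is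
  a set of such relations; \<open>cards_eq\<close> is equality of sets of cardinals, possibly
  represented over different types.

  A Hausdorff space with a dense subset of cardinality \<open>\<kappa>\<close> has at most \<open>2^(2^\<kappa>)\<close> points,
  so if \<open>\<kappa>\<close> is a cardinal over \<^typ>\<open>'b\<close>, every such space has a homeomorphic copy on a
  subset of \<^typ>\<open>'b set set\<close>; existence of a space may be asserted on that type.
\<close>

definition cards_eq :: "'b rel set \<Rightarrow> 'a rel set \<Rightarrow> bool" where
  "cards_eq S T \<longleftrightarrow> (\<forall>r\<in>S. \<exists>t\<in>T. r =o t) \<and> (\<forall>t\<in>T. \<exists>r\<in>S. r =o t)"

definition is_card_min :: "'b rel \<Rightarrow> 'b rel set \<Rightarrow> bool" where
  "is_card_min k S \<longleftrightarrow> k \<in> S \<and> (\<forall>r\<in>S. k \<le>o r)"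

text \<open>
  It suffices to compare with upper bounds over the same type: the cardinals over
  \<^typ>\<open>'b\<close> are exactly those up to the cardinality of \<^typ>\<open>'b\<close>, so every set of
  them has its supremum over \<^typ>\<open>'b\<close> (see \<open>is_card_sup_exists\<close> and \<open>is_card_sup_least\<close>).
\<close>

definition is_card_sup :: "'b rel \<Rightarrow> 'b rel set \<Rightarrow> bool" where
  "is_card_sup s S \<longleftrightarrow> Card_order s \<and> (\<forall>r\<in>S. r \<le>o s) \<and>
     (\<forall>t :: 'b rel. Card_order t \<longrightarrow> (\<forall>r\<in>S. r \<le>o t) \<longrightarrow> s \<le>o t)"

definition omega_closed :: "'b rel set \<Rightarrow> bool" where
  "omega_closed S \<longleftrightarrow>
     (\<forall>C. C \<subseteq> S \<longrightarrow> C \<noteq> {} \<longrightarrow> countable C \<longrightarrow> (\<exists>s\<in>S. is_card_sup s C))"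

definition crowded_space :: "'a topology \<Rightarrow> bool" where
  "crowded_space X \<longleftrightarrow> \<not> (\<exists>x\<in>topspace X. openin X {x})"

definition dense_subspaces :: "'a topology \<Rightarrow> 'a set set" where
  "dense_subspaces X = {D. D \<subseteq> topspace X \<and> X closure_of D = topspace X}"

definition density :: "'a topology \<Rightarrow> 'a rel" where
  "density X = |SOME D. D \<in> dense_subspaces X \<and> (\<forall>E\<in>dense_subspaces X. |D| \<le>o |E| )|"

definition double_density_spectrum :: "'a topology \<Rightarrow> 'a rel set" where
  "double_density_spectrum X = (\<lambda>D. density (subtopology X D)) ` dense_subspaces X"

lemma is_card_sup_exists:
  fixes S :: "'b rel set"
  assumes "\<forall>r\<in>S. Card_order r"
  shows "\<exists>s. is_card_sup s S"
proof -
  let ?U = "{t :: 'b rel. Card_order t \<and> (\<forall>r\<in>S. r \<le>o t)}"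
  have "r \<le>o |UNIV :: 'b set|" if "r \<in> S" for r
    using ordIso_ordLeq_trans[OF ordIso_symmetric[OF card_of_Field_ordIso[of r]]
        card_of_mono1[of "Field r" UNIV]] assms that by simp
  then have "|UNIV :: 'b set| \<in> ?U"
    by (simp add: card_of_Card_order)
  then obtain s where "s \<in> ?U" "\<forall>t\<in>?U. s \<le>o t"
    using exists_minim_Card_order[of ?U] by blast
  then show ?thesis
    unfolding is_card_sup_def by blast
qed

lemma is_card_sup_least:
  fixes S :: "'b rel set" and t :: "'c rel"
  assumes sup: "is_card_sup s S" and t: "Card_order t" "\<forall>r\<in>S. r \<le>o t"
  shows "s \<le>o t"
proof (rule ccontr)
  assume neg: "\<not> s \<le>o t"
  have "Well_order s" "Well_order t"
    using sup t(1) by (simp_all add: is_card_sup_def card_order_on_def)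
  with neg have "t \<le>o s"
    using ordLeq_total by blast
  then have "|Field t| \<le>o |Field s|"
    by (rule card_of_mono2)
  then obtain f :: "'c \<Rightarrow> 'b" where f: "inj_on f (Field t)"
    unfolding card_of_ordLeq[symmetric] by (elim exE conjE)
  have "|Field t| =o |f ` Field t|"
    using card_of_ordIsoI[OF inj_on_imp_bij_betw[OF f]] .
  then have iso: "t =o |f ` Field t|"
    using ordIso_transitive[OF ordIso_symmetric[OF card_of_Field_ordIso[OF t(1)]]] by simp
  have "\<forall>r\<in>S. r \<le>o |f ` Field t|"
    using t(2) by (auto intro: ordLeq_ordIso_trans[OF _ iso])
  then have "s \<le>o |f ` Field t|"
    using sup by (simp add: is_card_sup_def card_of_Card_order)
  then show False
    using neg by (auto intro: ordLeq_ordIso_trans[OF _ ordIso_symmetric[OF iso]])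
qed

lemma density_minimum:
  obtains D where "D \<in> dense_subspaces X" "density X = |D|"
    "\<And>E. E \<in> dense_subspaces X \<Longrightarrow> |D| \<le>o |E|"
proof -
  let ?P = "\<lambda>D. D \<in> dense_subspaces X \<and> (\<forall>E\<in>dense_subspaces X. |D| \<le>o |E| )"
  have "topspace X \<in> dense_subspaces X"
    by (simp add: dense_subspaces_def)
  then have "\<exists>r \<in> card_of ` dense_subspaces X. \<forall>r' \<in> card_of ` dense_subspaces X. r \<le>o r'"
    by (intro exists_minim_Card_order) (auto simp: card_of_Card_order)
  then have "\<exists>D. ?P D"
    by auto
  then have "?P (SOME D. ?P D)"
    by (rule someI_ex)
  then show thesis
    using that[of "SOME D. ?P D"] by (simp add: density_def)
qed

end

(*
  In the Cantor cube 2^(2^\<kappa>) the clopen subsets of 2^\<kappa> form a dense subgroup of size \<kappa>, so there are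
  2^(2^\<kappa>) disjoint dense cosets of size \<kappa>.  For each r in S let Y r be a union of r many of them, the
  Y r being disjoint; every cylinder meets Y r in exactly r points.  Let X be the union of the Y r, and
  refine its subspace topology by declaring closed every N such that each cylinder U and each r admit a
  smaller cylinder V with fewer than r points in N \<inter> Y r \<inter> V.  Then every Y r is dense of density r.
  Conversely, a dense D has, inside every cylinder, a smaller one V and an r such that D \<inter> Y r has r
  points in each cylinder below V.  Taking r minimal and using that the cube is ccc, the density of D is
  the supremum of countably many such r, hence lies in S.
*)

theory Submission
  imports Defs
begin

section \<open>Spaces with graded layers\<close>

lemma not_card_of_ordLess_iff: "Card_order r \<Longrightarrow> \<not> |A| <o r \<longleftrightarrow> r \<le>o |A|"
  using not_ordLess_iff_ordLeq card_of_Well_order card_order_on_well_order_on by blast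

text \<open>These are the facts about the Cantor cube from which the spectrum is computed.
  \<open>B\<close> stands for the cylinders, \<open>countable_disjoint\<close> is the ccc, and
  \<open>card_layer\<close> with \<open>card_layer_Int\<close> gives every layer the same size
  inside each basic set. \<open>Int_base\<close> excludes empty intersections because
  \<open>card_layer_Int\<close> keeps the empty set out of \<open>B\<close>.\<close>

locale graded_base =
  fixes B :: "'a set set" and T :: "'b rel set" and Y :: "'b rel \<Rightarrow> 'a set"
  assumes Int_base: "\<lbrakk>U \<in> B; V \<in> B; U \<inter> V \<noteq> {}\<rbrakk> \<Longrightarrow> U \<inter> V \<in> B"
    and countable_disjoint: "\<lbrakk>\<V> \<subseteq> B; pairwise disjnt \<V>\<rbrakk> \<Longrightarrow> countable \<V>"
    and base_nonempty: "B \<noteq> {}"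
    and grades_nonempty: "T \<noteq> {}"
    and Cinfinite_grade: "r \<in> T \<Longrightarrow> Cinfinite r"
    and omega_closed_grades: "omega_closed T"
    and card_layer: "r \<in> T \<Longrightarrow> |Y r| \<le>o r"
    and card_layer_Int: "\<lbrakk>r \<in> T; U \<in> B\<rbrakk> \<Longrightarrow> r \<le>o |Y r \<inter> U|"
    and disjoint_layers: "\<lbrakk>r \<in> T; s \<in> T; r \<noteq> s\<rbrakk> \<Longrightarrow> Y r \<inter> Y s = {}"
    and separated: "\<lbrakk>x \<in> \<Union>(Y ` T); y \<in> \<Union>(Y ` T); x \<noteq> y\<rbrakk>
      \<Longrightarrow> \<exists>U\<in>B. \<exists>V\<in>B. x \<in> U \<and> y \<in> V \<and> U \<inter> V = {}"
    and covered: "\<Union>(Y ` T) \<subseteq> \<Union>B"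
begin

definition points :: "'a set" where
  "points = \<Union>(Y ` T)"

text \<open>Negligible sets become closed and nowhere dense in \<open>graded_topology\<close>: this kills the
  sets of size less than \<open>r\<close> in \<open>Y r\<close>, and also the unions over all \<open>r\<close> of sets that are
  nowhere dense in the single layers \<open>Y r\<close>.\<close>

definition negligible :: "'a set \<Rightarrow> bool" where
  "negligible A \<longleftrightarrow> (\<forall>r\<in>T. \<forall>U\<in>B. \<exists>V\<in>B. V \<subseteq> U \<and> |A \<inter> Y r \<inter> V| <o r)"

text \<open>The local form of non-negligibility. It is inherited by smaller basic sets and larger
  \<open>A\<close>, which makes it the working notion for dense sets.\<close>

definition rich :: "'a set \<Rightarrow> 'b rel \<Rightarrow> 'a set \<Rightarrow> bool" where
  "rich A r U \<longleftrightarrow> (\<forall>V\<in>B. V \<subseteq> U \<longrightarrow> r \<le>o |A \<inter> Y r \<inter> V| )"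

text \<open>The refinement of a topology by an ideal: basic neighbourhoods are old basic sets minus
  a member of the ideal of negligible sets.\<close>

definition graded_topology :: "'a topology" where
  "graded_topology = topology (\<lambda>W. W \<subseteq> points \<and> (\<forall>x\<in>W. \<exists>U\<in>B. x \<in> U \<and> negligible (points \<inter> U - W)))"

section \<open>The ideal of negligible sets\<close>

lemma Card_order_grade: "r \<in> T \<Longrightarrow> Card_order r"
  using Cinfinite_grade by blast

lemma infinite_grade: "r \<in> T \<Longrightarrow> r \<le>o |A| \<Longrightarrow> infinite A"
  using cinfinite_mono[of r "|A|"] Cinfinite_grade[of r] by (simp add: cinfinite_def Field_card_of)

lemma not_negligible_iff: "\<not> negligible A \<longleftrightarrow> (\<exists>r\<in>T. \<exists>U\<in>B. rich A r U)"
  unfolding negligible_def rich_def using not_card_of_ordLess_iff[OF Card_order_grade] by blast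

lemma rich_mono: "rich A r U \<Longrightarrow> A \<subseteq> A' \<Longrightarrow> V \<subseteq> U \<Longrightarrow> rich A' r V"
  unfolding rich_def
  by (meson Int_mono card_of_mono1 order_refl ordLeq_transitive subset_trans)

lemma negligible_mono: "negligible A \<Longrightarrow> A' \<subseteq> A \<Longrightarrow> negligible A'"
  using not_negligible_iff rich_mono by blast

text \<open>Shrink the basic set for \<open>A\<close>, then again for \<open>A'\<close>. The first
  bound survives the second shrinking, and an infinite \<open>r\<close> is not the sum of two
  smaller cardinals.\<close>

lemma negligible_Un:
  assumes "negligible A" "negligible A'"
  shows "negligible (A \<union> A')"
  unfolding negligible_def
proof (intro ballI)
  fix r U assume r: "r \<in> T" and "U \<in> B"
  then obtain V where V: "V \<in> B" "V \<subseteq> U" "|A \<inter> Y r \<inter> V| <o r"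
    using assms(1) unfolding negligible_def by meson
  then obtain W where W: "W \<in> B" "W \<subseteq> V" "|A' \<inter> Y r \<inter> W| <o r"
    using r assms(2) unfolding negligible_def by meson
  have "|A \<inter> Y r \<inter> W| <o r"
    by (rule ordLeq_ordLess_trans[OF card_of_mono1 V(3)]) (use W in auto)
  with W(3) have "|(A \<inter> Y r \<inter> W) \<union> (A' \<inter> Y r \<inter> W)| <o r"
    using Un_Cinfinite_bound_strict Cinfinite_grade[OF r] by blast
  then have "|(A \<union> A') \<inter> Y r \<inter> W| <o r"
    by (simp add: Int_Un_distrib2)
  then show "\<exists>V\<in>B. V \<subseteq> U \<and> |(A \<union> A') \<inter> Y r \<inter> V| <o r"
    using W V by blast
qed

lemma negligible_finite:
  assumes "finite A"
  shows "negligible A"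
proof (rule ccontr)
  assume "\<not> negligible A"
  then obtain r U where "r \<in> T" "U \<in> B" "rich A r U"
    using not_negligible_iff by blast
  then have "infinite (A \<inter> Y r \<inter> U)"
    using infinite_grade unfolding rich_def by blast
  with assms show False
    by simp
qed

lemma rich_layer: "r \<in> T \<Longrightarrow> rich (Y r) r U"
  unfolding rich_def using card_layer_Int by simp

lemma nonempty_base: "U \<in> B \<Longrightarrow> U \<noteq> {}"
  using grades_nonempty card_layer_Int infinite_grade by fastforce

text \<open>Any single layer is already rich in every basic set. Both crowdedness and the
  description of dense sets depend on this.\<close>

lemma not_negligible_base:
  assumes "U \<in> B"
  shows "\<not> negligible (points \<inter> U)"
proof -
  obtain r where r: "r \<in> T"
    using grades_nonempty by blast
  have "rich (points \<inter> U) r U"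
    unfolding rich_def
  proof (intro ballI impI)
    fix V assume V: "V \<in> B" "V \<subseteq> U"
    then have "points \<inter> U \<inter> Y r \<inter> V = Y r \<inter> V"
      using r by (auto simp: points_def)
    then show "r \<le>o |points \<inter> U \<inter> Y r \<inter> V|"
      using card_layer_Int[OF r V(1)] by simp
  qed
  then show ?thesis
    using not_negligible_iff r assms by blast
qed

section \<open>The graded topology: Hausdorff and crowded\<close>

text \<open>The ideal properties make the defining predicate a topology: for an intersection the two
  exceptional sets are united, for a union the exceptional set only shrinks.\<close>

lemma openin_graded_topology:
  "openin graded_topology W \<longleftrightarrow> W \<subseteq> points \<and> (\<forall>x\<in>W. \<exists>U\<in>B. x \<in> U \<and> negligible (points \<inter> U - W))"
proof -
  let ?P = "\<lambda>W. W \<subseteq> points \<and> (\<forall>x\<in>W. \<exists>U\<in>B. x \<in> U \<and> negligible (points \<inter> U - W))"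
  have "?P (W1 \<inter> W2)" if W: "?P W1" "?P W2" for W1 W2
  proof (intro conjI ballI)
    fix x assume x: "x \<in> W1 \<inter> W2"
    with W obtain U1 U2 where U: "U1 \<in> B" "x \<in> U1" "negligible (points \<inter> U1 - W1)"
      "U2 \<in> B" "x \<in> U2" "negligible (points \<inter> U2 - W2)"
      by blast
    have "negligible (points \<inter> (U1 \<inter> U2) - W1 \<inter> W2)"
      by (rule negligible_mono[OF negligible_Un[OF U(3,6)]]) auto
    then show "\<exists>U\<in>B. x \<in> U \<and> negligible (points \<inter> U - W1 \<inter> W2)"
      using Int_base[OF U(1,4)] U by blast
  qed (use W in auto)
  moreover have "?P (\<Union>\<K>)" if K: "\<forall>W\<in>\<K>. ?P W" for \<K>
  proof (intro conjI ballI)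
    fix x assume "x \<in> \<Union>\<K>"
    then obtain W where W: "W \<in> \<K>" "x \<in> W" by blast
    then obtain U where U: "U \<in> B" "x \<in> U" "negligible (points \<inter> U - W)"
      using K by blast
    have "negligible (points \<inter> U - \<Union>\<K>)"
      by (rule negligible_mono[OF U(3)]) (use W in auto)
    then show "\<exists>U\<in>B. x \<in> U \<and> negligible (points \<inter> U - \<Union>\<K>)"
      using U by blast
  qed (use K in blast)
  ultimately have "istopology ?P"
    unfolding istopology_def by blast
  then show ?thesis
    by (simp add: graded_topology_def)
qed

lemma openin_base:
  assumes "U \<in> B"
  shows "openin graded_topology (points \<inter> U)"
  unfolding openin_graded_topology
proof (intro conjI ballI bexI[OF _ assms])
  show "negligible (points \<inter> U - points \<inter> U)"
    using negligible_finite by simp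
qed auto

lemma topspace_graded_topology [simp]: "topspace graded_topology = points"
proof
  show "topspace graded_topology \<subseteq> points"
    using openin_topspace[of graded_topology] openin_graded_topology by blast
  show "points \<subseteq> topspace graded_topology"
    using covered openin_subset[OF openin_base] unfolding points_def by blast
qed

lemma Hausdorff_graded_topology: "Hausdorff_space graded_topology"
  unfolding Hausdorff_space_def
proof (intro allI impI, elim conjE)
  fix x y assume xy: "x \<in> topspace graded_topology" "y \<in> topspace graded_topology" "x \<noteq> y"
  then obtain U V where UV: "U \<in> B" "V \<in> B" "x \<in> U" "y \<in> V" "U \<inter> V = {}"
    using separated[of x y] by (auto simp: points_def)
  then have "x \<in> points \<inter> U" "y \<in> points \<inter> V" "disjnt (points \<inter> U) (points \<inter> V)"
    using xy by (auto simp: disjnt_def)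
  then show "\<exists>U V. openin graded_topology U \<and> openin graded_topology V \<and> x \<in> U \<and> y \<in> V \<and> disjnt U V"
    using openin_base UV by blast
qed

text \<open>An isolated point would be all of some basic set up to a negligible set, which would
  make that basic set negligible in \<open>points\<close>.\<close>

lemma crowded_graded_topology: "crowded_space graded_topology"
  unfolding crowded_space_def
proof
  assume "\<exists>x\<in>topspace graded_topology. openin graded_topology {x}"
  then obtain x U where U: "U \<in> B" "negligible (points \<inter> U - {x})"
    unfolding openin_graded_topology by blast
  have "negligible (points \<inter> U)"
    by (rule negligible_mono[OF negligible_Un[OF U(2) negligible_finite[of "{x}"]]]) auto
  with not_negligible_base U show False by blast
qed

section \<open>Dense subspaces and their densities\<close>

text \<open>If \<open>D\<close> is negligible inside a basic set, deleting it there leaves a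
  nonempty open set that misses \<open>D\<close>. Conversely, a nonempty open set fills some basic
  set up to a negligible set, which cannot swallow a rich part of \<open>D\<close>.\<close>

lemma dense_iff:
  "D \<in> dense_subspaces graded_topology \<longleftrightarrow>
    D \<subseteq> points \<and> (\<forall>U\<in>B. \<exists>r\<in>T. \<exists>V\<in>B. V \<subseteq> U \<and> rich D r V)"
proof (cases "D \<subseteq> points")
  case True
  have "(\<forall>W. openin graded_topology W \<and> W \<noteq> {} \<longrightarrow> D \<inter> W \<noteq> {}) \<longleftrightarrow>
      (\<forall>U\<in>B. \<exists>r\<in>T. \<exists>V\<in>B. V \<subseteq> U \<and> rich D r V)" (is "?L \<longleftrightarrow> ?R")
  proof
    assume L: ?L
    show ?R
    proof
      fix U assume U: "U \<in> B"
      have "\<not> negligible (D \<inter> U)"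
      proof
        assume n: "negligible (D \<inter> U)"
        have "openin graded_topology (points \<inter> U - D)"
          unfolding openin_graded_topology
        proof (intro conjI ballI bexI[OF _ U])
          show "negligible (points \<inter> U - (points \<inter> U - D))"
            by (rule negligible_mono[OF n]) auto
        qed auto
        moreover have "D \<inter> (points \<inter> U - D) = {}"
          by blast
        ultimately have "points \<inter> U - D = {}"
          using L by blast
        then have "points \<inter> U \<subseteq> D \<inter> U"
          by blast
        with n show False
          using negligible_mono not_negligible_base[OF U] by blast
      qed
      \<comment> \<open>This \<open>V\<close> need not lie below \<open>U\<close>, but it contains
        infinitely many points of \<open>D \<inter> U\<close>; hence \<open>V \<inter> U\<close> is
        a basic set below \<open>U\<close> and inherits the richness.\<close>
      then obtain r V where rV: "r \<in> T" "V \<in> B" "rich (D \<inter> U) r V"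
        using not_negligible_iff by blast
      then have "r \<le>o |D \<inter> U \<inter> Y r \<inter> V|"
        unfolding rich_def by blast
      then have "infinite (D \<inter> U \<inter> Y r \<inter> V)"
        using infinite_grade[OF rV(1)] by blast
      then have "V \<inter> U \<noteq> {}"
        by (metis Int_assoc Int_commute Int_empty_right finite.emptyI)
      then have "V \<inter> U \<in> B" "rich D r (V \<inter> U)"
        using Int_base rV U by (auto intro: rich_mono)
      then show "\<exists>r\<in>T. \<exists>V\<in>B. V \<subseteq> U \<and> rich D r V"
        using rV by blast
    qed
  next
    assume R: ?R
    show ?L
    proof (intro allI impI, elim conjE)
      fix W assume "openin graded_topology W" "W \<noteq> {}"
      then obtain U where U: "U \<in> B" "negligible (points \<inter> U - W)"
        unfolding openin_graded_topology by blast
      then obtain r V where V: "r \<in> T" "V \<in> B" "V \<subseteq> U" "rich D r V"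
        using R by blast
      have "rich (D \<inter> U) r V"
        unfolding rich_def
      proof (intro ballI impI)
        fix V' assume V': "V' \<in> B" "V' \<subseteq> V"
        then have "D \<inter> U \<inter> Y r \<inter> V' = D \<inter> Y r \<inter> V'"
          using V by blast
        then show "r \<le>o |D \<inter> U \<inter> Y r \<inter> V'|"
          using V V' unfolding rich_def by simp
      qed
      then have "\<not> negligible (D \<inter> U)"
        using not_negligible_iff V by blast
      then have "\<not> D \<inter> U \<subseteq> points \<inter> U - W"
        using negligible_mono[OF U(2)] by blast
      then show "D \<inter> W \<noteq> {}"
        using True by blast
    qed
  qed
  then show ?thesis
    using True dense_intersects_open[of graded_topology D] by (simp add: dense_subspaces_def)
qed (simp add: dense_subspaces_def)

text \<open>The dense subsets of a dense \<open>D\<close> are exactly the dense subsets of the whole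
  space that lie in \<open>D\<close>, so the density of \<open>D\<close> can be computed without its
  subspace topology.\<close>

lemma density_subspace_eqI:
  assumes D: "D \<in> dense_subspaces graded_topology"
    and E: "E \<in> dense_subspaces graded_topology" "E \<subseteq> D" "|E| \<le>o s"
    and least: "\<And>E'. E' \<in> dense_subspaces graded_topology \<Longrightarrow> E' \<subseteq> D \<Longrightarrow> s \<le>o |E'|"
  shows "s =o density (subtopology graded_topology D)"
proof -
  have D_eq: "E' \<in> dense_subspaces (subtopology graded_topology D) \<longleftrightarrow>
      E' \<in> dense_subspaces graded_topology \<and> E' \<subseteq> D" for E'
  proof (cases "E' \<subseteq> D")
    case True
    have "D \<subseteq> graded_topology closure_of E' \<longleftrightarrow> graded_topology closure_of E' = points"
      using D closure_of_minimal[of D "graded_topology closure_of E'" graded_topology]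
        closure_of_subset_topspace[of graded_topology E']
      by (auto simp: dense_subspaces_def)
    then show ?thesis
      using True D by (auto simp: dense_subspaces_def closure_of_subtopology Int_absorb1)
  qed (auto simp: dense_subspaces_def)
  obtain M where M: "M \<in> dense_subspaces (subtopology graded_topology D)"
    "density (subtopology graded_topology D) = |M|"
    "\<And>E'. E' \<in> dense_subspaces (subtopology graded_topology D) \<Longrightarrow> |M| \<le>o |E'|"
    using density_minimum by blast
  have "s \<le>o |M|"
    using least M(1) D_eq by blast
  moreover have "|M| \<le>o s"
    using M(3) D_eq E ordLeq_transitive by blast
  ultimately show ?thesis
    unfolding M(2) by (simp add: ordIso_iff_ordLeq)
qed

lemma layer_dense: "r \<in> T \<Longrightarrow> Y r \<in> dense_subspaces graded_topology"
  unfolding dense_iff using rich_layer by (auto simp: points_def)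

text \<open>A dense subset of \<open>Y r\<close> is rich for some grade, and disjointness of the
  layers leaves only the grade \<open>r\<close>.\<close>

lemma density_layer:
  assumes r: "r \<in> T"
  shows "r =o density (subtopology graded_topology (Y r))"
proof (rule density_subspace_eqI[OF layer_dense layer_dense])
  fix E assume E: "E \<in> dense_subspaces graded_topology" "E \<subseteq> Y r"
  obtain s U where s: "s \<in> T" "U \<in> B" "rich E s U"
    using E(1) base_nonempty unfolding dense_iff by blast
  then have *: "s \<le>o |E \<inter> Y s \<inter> U|"
    unfolding rich_def by blast
  then have "E \<inter> Y s \<noteq> {}"
    using infinite_grade[OF s(1)] by fastforce
  then have "s = r"
    using E(2) disjoint_layers[OF r s(1)] by blast
  with * show "r \<le>o |E|"
    using ordLeq_transitive[OF _ card_of_mono1] by (metis Int_assoc inf_le1)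
qed (use r card_layer in auto)

text \<open>Below \<open>U\<close>, the grade \<open>r\<close> is the least one for which
  \<open>D\<close> is rich anywhere. This turns \<open>r\<close> into a lower bound for dense
  subsets of \<open>D\<close>.\<close>

definition pure :: "'a set \<Rightarrow> 'b rel \<Rightarrow> 'a set \<Rightarrow> bool" where
  "pure D r U \<longleftrightarrow> rich D r U \<and> (\<forall>s\<in>T. \<forall>V\<in>B. V \<subseteq> U \<longrightarrow> rich D s V \<longrightarrow> r \<le>o s)"

lemma pure_exists:
  assumes "D \<in> dense_subspaces graded_topology" "U \<in> B"
  obtains r V where "r \<in> T" "V \<in> B" "V \<subseteq> U" "pure D r V"
proof -
  let ?R = "{r\<in>T. \<exists>V\<in>B. V \<subseteq> U \<and> rich D r V}"
  have "?R \<noteq> {}"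
    using assms unfolding dense_iff by blast
  then obtain r where r: "r \<in> ?R" "\<forall>s\<in>?R. r \<le>o s"
    using exists_minim_Card_order[of ?R] Card_order_grade by blast
  then obtain V where V: "V \<in> B" "V \<subseteq> U" "rich D r V"
    by blast
  then have "pure D r V"
    unfolding pure_def using r by blast
  then show thesis
    using that r V by blast
qed

text \<open>\<open>E\<close> is rich for some grade \<open>s\<close> below \<open>U\<close>; so is
  the larger set \<open>D\<close>, and purity gives that \<open>s\<close> is at least
  \<open>r\<close>.\<close>

lemma pure_le_card_dense:
  assumes "pure D r U" "U \<in> B" "E \<in> dense_subspaces graded_topology" "E \<subseteq> D"
  shows "r \<le>o |E|"
proof -
  obtain s V where V: "s \<in> T" "V \<in> B" "V \<subseteq> U" "rich E s V"
    using assms(2,3) unfolding dense_iff by blast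
  have "r \<le>o s"
    using assms(1) V(1-3) rich_mono[OF V(4) assms(4) order_refl] unfolding pure_def by blast
  also have "s \<le>o |E \<inter> Y s \<inter> V|"
    using V unfolding rich_def by blast
  also have "|E \<inter> Y s \<inter> V| \<le>o |E|"
    by (rule card_of_mono1) auto
  finally show ?thesis .
qed

text \<open>Mixing over a maximal disjoint family of pure sets, which is countable, shows that the
  density of \<open>D\<close> is the supremum of countably many grades.\<close>

lemma density_dense:
  assumes D: "D \<in> dense_subspaces graded_topology"
  shows "\<exists>s\<in>T. s =o density (subtopology graded_topology D)"
proof -
  \<comment> \<open>By \<open>pure_exists\<close> every basic set contains a member of
    \<open>G\<close>, so a maximal disjoint subfamily of \<open>G\<close> meets every basic
    set.\<close>
  define G where "G = {V\<in>B. \<exists>r\<in>T. pure D r V}"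
  let ?A = "{\<V>. \<V> \<subseteq> G \<and> pairwise disjnt \<V>}"
  have "\<exists>M\<in>?A. \<forall>\<V>\<in>?A. M \<subseteq> \<V> \<longrightarrow> \<V> = M"
  proof (rule subset_Zorn_nonempty)
    fix \<C> assume "subset.chain ?A \<C>"
    then show "\<Union>\<C> \<in> ?A"
      using pairwise_chain_Union[of \<C> disjnt] by (auto simp: subset.chain_def chain_subset_def)
  qed (auto intro: exI[of _ "{}"])
  then obtain M where M: "M \<subseteq> G" "pairwise disjnt M"
    and max: "\<And>\<V>. \<V> \<subseteq> G \<Longrightarrow> pairwise disjnt \<V> \<Longrightarrow> M \<subseteq> \<V> \<Longrightarrow> \<V> = M"
    unfolding mem_Collect_eq Bex_def Ball_def by (elim exE conjE) simp
  have "\<forall>V\<in>G. \<exists>r. r \<in> T \<and> pure D r V"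
    unfolding G_def by blast
  then obtain g where g: "\<And>V. V \<in> G \<Longrightarrow> g V \<in> T \<and> pure D (g V) V"
    unfolding bchoice_iff by blast
  have cM: "countable M"
    using countable_disjoint M unfolding G_def by blast
  have meets: "\<exists>W\<in>M. V \<inter> W \<noteq> {}" if "V \<in> G" for V
  proof (rule ccontr)
    assume *: "\<not> ?thesis"
    then have "pairwise disjnt (insert V M)"
      using M by (auto simp: pairwise_insert disjnt_def)
    then have "V \<in> M"
      using max[of "insert V M"] M that by blast
    with * show False
      using nonempty_base that unfolding G_def by blast
  qed
  obtain U where "U \<in> B"
    using base_nonempty by blast
  then obtain r V where "r \<in> T" "V \<in> B" "pure D r V"
    using pure_exists[OF D] by metis
  then have "G \<noteq> {}"
    unfolding G_def by blast
  then have "M \<noteq> {}"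
    using meets by blast
  obtain s where s: "s \<in> T" "is_card_sup s (g ` M)"
  proof -
    have "g ` M \<subseteq> T" "g ` M \<noteq> {}" "countable (g ` M)"
      using g M(1) cM \<open>M \<noteq> {}\<close> by auto
    then show thesis
      using omega_closed_grades that unfolding omega_closed_def by blast
  qed
  \<comment> \<open>Inside each member of \<open>M\<close> only the layer of its pure grade is kept.
    This leaves countably many pieces, each of size at most \<open>s\<close>.\<close>
  define E where "E = (\<Union>V\<in>M. D \<inter> Y (g V) \<inter> V)"
  have "|M| \<le>o natLeq"
  proof -
    obtain f :: "'a set \<Rightarrow> nat" where "inj_on f M"
      using cM by (auto simp: countable_def)
    then have "|M| \<le>o |UNIV :: nat set|"
      by (intro card_of_ordLeqI) auto
    then show ?thesis
      using ordLeq_ordIso_trans card_of_nat by blast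
  qed
  then have M_le: "|M| \<le>o s"
    using Cinfinite_grade[OF s(1)] natLeq_ordLeq_cinfinite ordLeq_transitive by blast
  have "|D \<inter> Y (g V) \<inter> V| \<le>o s" if "V \<in> M" for V
  proof -
    have "|D \<inter> Y (g V) \<inter> V| \<le>o |Y (g V)|"
      by (rule card_of_mono1) auto
    also have "|Y (g V)| \<le>o g V"
      using card_layer g M that by blast
    also have "g V \<le>o s"
      using s(2) that by (auto simp: is_card_sup_def)
    finally show ?thesis .
  qed
  then have E_le: "|E| \<le>o s"
    unfolding E_def by (intro UNION_Cinfinite_bound[OF M_le _ Cinfinite_grade[OF s(1)]] ballI)
  have "\<exists>r\<in>T. \<exists>V\<in>B. V \<subseteq> U \<and> rich E r V" if U: "U \<in> B" for U
  proof -
    obtain r V where rV: "r \<in> T" "V \<in> B" "V \<subseteq> U" "pure D r V"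
      using pure_exists[OF D U] .
    then obtain W where W: "W \<in> M" "V \<inter> W \<noteq> {}"
      using meets unfolding G_def by blast
    then have VW: "V \<inter> W \<in> B" and gW: "g W \<in> T" "rich D (g W) W"
      using Int_base[OF rV(2)] M(1) g[of W] unfolding G_def pure_def by auto
    \<comment> \<open>Within \<open>W\<close>, the set \<open>E\<close> keeps all of
      \<open>D \<inter> Y (g W)\<close>, so the richness of \<open>D\<close> in \<open>W\<close>
      carries over. The grade obtained is that of \<open>W\<close>, not that of
      \<open>V\<close>.\<close>
    have "rich E (g W) (V \<inter> W)"
      unfolding rich_def
    proof (intro ballI impI)
      fix V' assume V': "V' \<in> B" "V' \<subseteq> V \<inter> W"
      have "g W \<le>o |D \<inter> Y (g W) \<inter> V'|"
        using gW V' unfolding rich_def by blast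
      also have "|D \<inter> Y (g W) \<inter> V'| \<le>o |E \<inter> Y (g W) \<inter> V'|"
        by (rule card_of_mono1) (use W V' in \<open>auto simp: E_def\<close>)
      finally show "g W \<le>o |E \<inter> Y (g W) \<inter> V'|" .
    qed
    then show ?thesis
      using VW gW rV by blast
  qed
  then have E_dense: "E \<in> dense_subspaces graded_topology"
    using D unfolding dense_iff E_def by blast
  have "s =o density (subtopology graded_topology D)"
  proof (rule density_subspace_eqI[OF D E_dense _ E_le])
    show "E \<subseteq> D"
      by (auto simp: E_def)
    fix E' assume E': "E' \<in> dense_subspaces graded_topology" "E' \<subseteq> D"
    have "\<forall>r\<in>g ` M. r \<le>o |E'|"
      using pure_le_card_dense[OF _ _ E'] g M unfolding G_def by blast
    \<comment> \<open>The supremum is defined by upper bounds over the type of the grades, whereas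
      \<open>|E'|\<close> lives over the type of the points; \<open>is_card_sup_least\<close>
      bridges the two.\<close>
    then show "s \<le>o |E'|"
      using is_card_sup_least[OF s(2)] card_of_Card_order by blast
  qed
  then show ?thesis
    using s by blast
qed

lemma spectrum_graded_topology: "cards_eq T (double_density_spectrum graded_topology)"
  unfolding cards_eq_def double_density_spectrum_def
  using layer_dense density_layer density_dense by blast

end

section \<open>The Cantor cube\<close>

text \<open>Points of the cube \<open>2^I\<close> are coded as subsets of \<open>I\<close>;
  \<open>P\<close> holds the coordinates fixed to 1 and \<open>N\<close> those fixed to 0.\<close>

definition cylinder :: "'a set \<Rightarrow> 'a set \<Rightarrow> 'a set \<Rightarrow> 'a set set" where
  "cylinder I P N = {z. z \<subseteq> I \<and> P \<subseteq> z \<and> z \<inter> N = {}}"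

definition cylinders :: "'a set \<Rightarrow> 'a set set set" where
  "cylinders I = {cylinder I P N | P N.
     finite P \<and> finite N \<and> P \<subseteq> I \<and> N \<subseteq> I \<and> P \<inter> N = {}}"

text \<open>The coordinates outside \<open>P \<union> N\<close> are free. The product form expresses
  the measure of the cylinder without division.\<close>

lemma card_cylinder:
  assumes "finite J" "P \<subseteq> J" "N \<subseteq> J" "P \<inter> N = {}"
  shows "card (cylinder J P N) * 2 ^ (card P + card N) = 2 ^ card J"
proof -
  have fin: "finite P" "finite N"
    using assms by (auto intro: finite_subset)
  have "cylinder J P N = (\<lambda>z. z \<union> P) ` Pow (J - (P \<union> N))"
  proof
    show "cylinder J P N \<subseteq> (\<lambda>z. z \<union> P) ` Pow (J - (P \<union> N))"
    proof
      fix z assume "z \<in> cylinder J P N"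
      then have "z = (z - P) \<union> P" "z - P \<in> Pow (J - (P \<union> N))"
        by (auto simp: cylinder_def)
      then show "z \<in> (\<lambda>z. z \<union> P) ` Pow (J - (P \<union> N))"
        by (rule image_eqI)
    qed
  qed (use assms in \<open>auto simp: cylinder_def\<close>)
  moreover have "inj_on (\<lambda>z. z \<union> P) (Pow (J - (P \<union> N)))"
    by (auto simp: inj_on_def)
  ultimately have "card (cylinder J P N) = 2 ^ card (J - (P \<union> N))"
    using assms(1) by (simp add: card_image card_Pow)
  also have "card (J - (P \<union> N)) = card J - (card P + card N)"
    using assms fin by (simp add: card_Diff_subset card_Un_disjoint)
  finally show ?thesis
    using card_mono[OF assms(1), of "P \<union> N"] assms fin
    by (simp add: card_Un_disjoint flip: power_add)
qed

text \<open>A cylinder fixing \<open>n\<close> coordinates has measure \<open>2^-n\<close>, so at most \<open>2^n\<close> of them are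
  pairwise disjoint; measures are counted in a finite subcube.\<close>

lemma card_disjoint_cylinders:
  assumes fin: "finite \<F>" and disj: "pairwise disjnt \<F>"
    and \<F>: "\<And>V. V \<in> \<F> \<Longrightarrow> \<exists>P N. V = cylinder I P N \<and> finite P \<and> finite N \<and>
      P \<subseteq> I \<and> N \<subseteq> I \<and> P \<inter> N = {} \<and> card P + card N = n"
  shows "card \<F> \<le> 2 ^ n"
proof -
  obtain P N where PN: "\<And>V. V \<in> \<F> \<Longrightarrow> V = cylinder I (P V) (N V) \<and>
      finite (P V) \<and> finite (N V) \<and> P V \<subseteq> I \<and> N V \<subseteq> I \<and> P V \<inter> N V = {} \<and>
      card (P V) + card (N V) = n"
    using \<F> by metis
  define J where "J = (\<Union>V\<in>\<F>. P V \<union> N V)"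
  have J: "finite J" "J \<subseteq> I"
    using fin PN unfolding J_def by (blast intro: finite_UN_I finite_UnI)+
  have PJ: "P V \<subseteq> J" "N V \<subseteq> J" if "V \<in> \<F>" for V
    using that by (auto simp: J_def)
  let ?C = "\<lambda>V. cylinder J (P V) (N V)"
  \<comment> \<open>A subset of \<open>J\<close> is a point of the big cube with value 0 off
    \<open>J\<close>. Hence the finite traces stay inside the given cylinders and remain
    disjoint.\<close>
  have sub: "?C V \<subseteq> V" if "V \<in> \<F>" for V
  proof -
    have "?C V \<subseteq> cylinder I (P V) (N V)"
      using J(2) by (auto simp: cylinder_def)
    then show ?thesis
      using PN[OF that] by simp
  qed
  have finC: "finite (?C V)" for V
    using finite_subset[of "?C V" "Pow J"] J(1) by (auto simp: cylinder_def)
  have "card \<F> * 2 ^ card J = (\<Sum>V\<in>\<F>. card (?C V) * 2 ^ n)"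
  proof -
    have "card (?C V) * 2 ^ n = 2 ^ card J" if "V \<in> \<F>" for V
      using card_cylinder[OF J(1) PJ[OF that]] PN[OF that] by simp
    then show ?thesis
      by simp
  qed
  also have "\<dots> = card (\<Union>V\<in>\<F>. ?C V) * 2 ^ n"
  proof -
    have "?C V \<inter> ?C W = {}" if "V \<in> \<F>" "W \<in> \<F>" "V \<noteq> W" for V W
    proof -
      have "V \<inter> W = {}"
        using disj that by (simp add: pairwise_def disjnt_def)
      then show ?thesis
        using sub[OF that(1)] sub[OF that(2)] by blast
    qed
    then have "card (\<Union>V\<in>\<F>. ?C V) = (\<Sum>V\<in>\<F>. card (?C V))"
      using fin finC by (intro card_UN_disjoint) auto
    then show ?thesis
      by (simp add: sum_distrib_right)
  qed
  also have "\<dots> \<le> card (Pow J) * 2 ^ n"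
    using J(1) by (intro mult_right_mono card_mono) (auto simp: cylinder_def)
  finally show ?thesis
    using J(1) by (simp add: card_Pow)
qed

text \<open>Sorted by the number of fixed coordinates, the family splits into countably many
  classes, each finite by the measure bound.\<close>

lemma countable_disjoint_cylinders:
  assumes \<V>: "\<V> \<subseteq> cylinders I" and disj: "pairwise disjnt \<V>"
  shows "countable \<V>"
proof -
  define C where "C n = {V\<in>\<V>. \<exists>P N. V = cylinder I P N \<and> finite P \<and> finite N \<and>
      P \<subseteq> I \<and> N \<subseteq> I \<and> P \<inter> N = {} \<and> card P + card N = n}" for n
  have "finite (C n)" for n
  proof -
    have "card \<F> \<le> 2 ^ n" if "\<F> \<subseteq> C n" "finite \<F>" for \<F>
    proof (rule card_disjoint_cylinders[OF that(2)])
      show "pairwise disjnt \<F>"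
        by (rule pairwise_subset[OF disj]) (use that(1) in \<open>auto simp: C_def\<close>)
    qed (use that(1) in \<open>auto simp: C_def\<close>)
    then show ?thesis
      using finite_if_finite_subsets_card_bdd by blast
  qed
  moreover have "\<V> \<subseteq> (\<Union>n. C n)"
  proof
    fix V assume "V \<in> \<V>"
    moreover from this obtain P N where "V = cylinder I P N" "finite P" "finite N"
        "P \<subseteq> I" "N \<subseteq> I" "P \<inter> N = {}"
      using \<V> unfolding cylinders_def by blast
    ultimately have "V \<in> C (card P + card N)"
      unfolding C_def by blast
    then show "V \<in> (\<Union>n. C n)"
      by blast
  qed
  moreover have "countable (\<Union>n. C n)"
    using \<open>\<And>n. finite (C n)\<close> by (simp add: countable_finite)
  ultimately show ?thesis
    using countable_subset by blast
qed

lemma Int_cylinders: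
  assumes "U \<in> cylinders I" "V \<in> cylinders I" "U \<inter> V \<noteq> {}"
  shows "U \<inter> V \<in> cylinders I"
proof -
  obtain P N where PN: "U = cylinder I P N" "finite P" "finite N" "P \<subseteq> I" "N \<subseteq> I"
    using assms(1) unfolding cylinders_def by blast
  obtain P' N' where PN': "V = cylinder I P' N'" "finite P'" "finite N'" "P' \<subseteq> I" "N' \<subseteq> I"
    using assms(2) unfolding cylinders_def by blast
  have "finite (P \<union> P')" "finite (N \<union> N')" "P \<union> P' \<subseteq> I" "N \<union> N' \<subseteq> I"
    using PN PN' by auto
  moreover have "U \<inter> V = cylinder I (P \<union> P') (N \<union> N')"
    using PN(1) PN'(1) by (auto simp: cylinder_def)
  \<comment> \<open>A common element would have to both belong and not belong to any point of
    \<open>U \<inter> V\<close>.\<close>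
  moreover have "(P \<union> P') \<inter> (N \<union> N') = {}"
    using assms(3) PN(1) PN'(1) by (auto simp: cylinder_def)
  ultimately show ?thesis
    unfolding cylinders_def by blast
qed

lemma cylinders_separate:
  assumes "x \<subseteq> I" "y \<subseteq> I" "x \<noteq> y"
  shows "\<exists>U\<in>cylinders I. \<exists>V\<in>cylinders I. x \<in> U \<and> y \<in> V \<and> U \<inter> V = {}"
proof -
  obtain i where i: "i \<in> I" "i \<in> x \<longleftrightarrow> i \<notin> y"
    using assms by blast
  have U: "cylinder I {i} {} \<in> cylinders I" and V: "cylinder I {} {i} \<in> cylinders I"
    using i by (auto simp: cylinders_def intro: exI[of _ "{i}"] exI[of _ "{}"])
  have disj: "cylinder I {i} {} \<inter> cylinder I {} {i} = {}"
    by (auto simp: cylinder_def)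
  show ?thesis
  proof (cases "i \<in> x")
    case True
    then have "x \<in> cylinder I {i} {}" "y \<in> cylinder I {} {i}"
      using i assms by (auto simp: cylinder_def)
    then show ?thesis
      using U V disj by blast
  next
    case False
    then have "y \<in> cylinder I {i} {}" "x \<in> cylinder I {} {i}"
      using i assms by (auto simp: cylinder_def)
    then show ?thesis
      using U V disj by blast
  qed
qed

lemma Pow_in_cylinders: "Pow I \<in> cylinders I"
proof -
  have "cylinder I {} {} = Pow I"
    by (auto simp: cylinder_def)
  then show ?thesis
    unfolding cylinders_def by blast
qed

section \<open>Dense cosets of the clopen subgroup\<close>

text \<open>Two points of the Cantor cube \<open>2^(2^K)\<close> are related if their symmetric difference depends on
  finitely many elements of \<open>K\<close>, i.e. is a clopen subset of \<open>2^K\<close>.  The clopen sets form a dense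
  subgroup of size \<open>|K|\<close>, as in the Hewitt-Marczewski-Pondiczery theorem.\<close>

definition clopen_diff :: "'a set \<Rightarrow> ('a set set \<times> 'a set set) set" where
  "clopen_diff K = {(x, y). x \<subseteq> Pow K \<and> y \<subseteq> Pow K \<and>
     (\<exists>F. finite F \<and> F \<subseteq> K \<and> (\<forall>A\<in>Pow K. \<forall>B\<in>Pow K. A \<inter> F = B \<inter> F \<longrightarrow>
        ((A \<in> x \<longleftrightarrow> A \<in> y) \<longleftrightarrow> (B \<in> x \<longleftrightarrow> B \<in> y))))}"

lemma clopen_diffI:
  assumes "x \<subseteq> Pow K" "y \<subseteq> Pow K" "finite F" "F \<subseteq> K"
    and "\<And>A B. \<lbrakk>A \<subseteq> K; B \<subseteq> K; A \<inter> F = B \<inter> F\<rbrakk> \<Longrightarrow>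
      (A \<in> x \<longleftrightarrow> A \<in> y) \<longleftrightarrow> (B \<in> x \<longleftrightarrow> B \<in> y)"
  shows "(x, y) \<in> clopen_diff K"
  unfolding clopen_diff_def
proof (intro CollectI case_prodI conjI exI[of _ F] ballI impI)
  fix A B assume "A \<in> Pow K" "B \<in> Pow K" "A \<inter> F = B \<inter> F"
  then show "(A \<in> x \<longleftrightarrow> A \<in> y) \<longleftrightarrow> (B \<in> x \<longleftrightarrow> B \<in> y)"
    by (intro assms(5)) auto
qed (fact assms)+

lemma clopen_diffE:
  assumes "(x, y) \<in> clopen_diff K"
  obtains F where "x \<subseteq> Pow K" "y \<subseteq> Pow K" "finite F" "F \<subseteq> K"
    "\<And>A B. \<lbrakk>A \<subseteq> K; B \<subseteq> K; A \<inter> F = B \<inter> F\<rbrakk> \<Longrightarrow>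
      (A \<in> x \<longleftrightarrow> A \<in> y) \<longleftrightarrow> (B \<in> x \<longleftrightarrow> B \<in> y)"
proof -
  note * = assms[unfolded clopen_diff_def mem_Collect_eq case_prod_conv]
  from *[THEN conjunct2, THEN conjunct2] obtain F where F: "finite F" "F \<subseteq> K"
      "\<forall>A\<in>Pow K. \<forall>B\<in>Pow K. A \<inter> F = B \<inter> F \<longrightarrow>
        ((A \<in> x \<longleftrightarrow> A \<in> y) \<longleftrightarrow> (B \<in> x \<longleftrightarrow> B \<in> y))"
    by (elim exE conjE)
  show thesis
  proof (rule that[OF *[THEN conjunct1] *[THEN conjunct2, THEN conjunct1] F(1,2)])
    fix A B assume "A \<subseteq> K" "B \<subseteq> K" "A \<inter> F = B \<inter> F"
    then show "(A \<in> x \<longleftrightarrow> A \<in> y) \<longleftrightarrow> (B \<in> x \<longleftrightarrow> B \<in> y)"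
      using F(3) by (metis PowI)
  qed
qed

text \<open>A finite support of the difference serves in both directions, and supports are united
  for transitivity. The classes are the cosets of the clopen subgroup.\<close>

lemma equiv_clopen_diff: "equiv (Pow (Pow K)) (clopen_diff K)"
proof (rule equivI)
  show "clopen_diff K \<subseteq> Pow (Pow K) \<times> Pow (Pow K)"
    by (auto simp: clopen_diff_def)
  show "refl_on (Pow (Pow K)) (clopen_diff K)"
    by (auto simp: refl_on_def clopen_diff_def)
  show "sym (clopen_diff K)"
  proof (rule symI)
    fix x y assume "(x, y) \<in> clopen_diff K"
    then obtain F where xy: "x \<subseteq> Pow K" "y \<subseteq> Pow K" "finite F" "F \<subseteq> K"
      and F: "\<And>A B. \<lbrakk>A \<subseteq> K; B \<subseteq> K; A \<inter> F = B \<inter> F\<rbrakk> \<Longrightarrow>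
        (A \<in> x \<longleftrightarrow> A \<in> y) \<longleftrightarrow> (B \<in> x \<longleftrightarrow> B \<in> y)"
      by (rule clopen_diffE) (rule that)
    show "(y, x) \<in> clopen_diff K"
    proof (rule clopen_diffI[OF xy(2,1,3,4)])
      fix A B assume "A \<subseteq> K" "B \<subseteq> K" "A \<inter> F = B \<inter> F"
      from F[OF this] show "(A \<in> y \<longleftrightarrow> A \<in> x) \<longleftrightarrow> (B \<in> y \<longleftrightarrow> B \<in> x)"
        by argo
    qed
  qed
  show "trans (clopen_diff K)"
  proof (rule transI)
    fix x y z assume xy: "(x, y) \<in> clopen_diff K" and yz: "(y, z) \<in> clopen_diff K"
    obtain F where F1: "x \<subseteq> Pow K" "y \<subseteq> Pow K" "finite F" "F \<subseteq> K"
      and F: "\<And>A B. \<lbrakk>A \<subseteq> K; B \<subseteq> K; A \<inter> F = B \<inter> F\<rbrakk> \<Longrightarrow>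
        (A \<in> x \<longleftrightarrow> A \<in> y) \<longleftrightarrow> (B \<in> x \<longleftrightarrow> B \<in> y)"
      using xy by (rule clopen_diffE) (rule that)
    obtain G where G1: "y \<subseteq> Pow K" "z \<subseteq> Pow K" "finite G" "G \<subseteq> K"
      and G: "\<And>A B. \<lbrakk>A \<subseteq> K; B \<subseteq> K; A \<inter> G = B \<inter> G\<rbrakk> \<Longrightarrow>
        (A \<in> y \<longleftrightarrow> A \<in> z) \<longleftrightarrow> (B \<in> y \<longleftrightarrow> B \<in> z)"
      using yz by (rule clopen_diffE) (rule that)
    have fin: "finite (F \<union> G)" "F \<union> G \<subseteq> K"
      using F1 G1 by auto
    show "(x, z) \<in> clopen_diff K"
    proof (rule clopen_diffI[OF F1(1) G1(2) fin])
      fix A B assume A: "A \<subseteq> K" and B: "B \<subseteq> K" and "A \<inter> (F \<union> G) = B \<inter> (F \<union> G)"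
      then have "A \<inter> F = B \<inter> F" "A \<inter> G = B \<inter> G"
        by blast+
      from F[OF A B this(1)] G[OF A B this(2)]
      show "(A \<in> x \<longleftrightarrow> A \<in> z) \<longleftrightarrow> (B \<in> x \<longleftrightarrow> B \<in> z)"
        by argo
    qed
  qed
qed

text \<open>The symmetric difference of \<open>x\<close> with the clopen set of all \<open>A\<close>
  whose trace on \<open>F\<close> lies in \<open>\<G>\<close>. The pair of \<open>F\<close> and
  \<open>\<G>\<close> is a finite code for a member of the coset of \<open>x\<close>.\<close>

definition flip :: "'a set \<Rightarrow> 'a set set \<Rightarrow> 'a set \<Rightarrow> 'a set set \<Rightarrow> 'a set set" where
  "flip K x F \<G> = {A \<in> Pow K. (A \<in> x) \<noteq> (A \<inter> F \<in> \<G>)}"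

lemma flip_clopen_diff:
  assumes "x \<subseteq> Pow K" "finite F" "F \<subseteq> K"
  shows "(x, flip K x F \<G>) \<in> clopen_diff K"
proof (rule clopen_diffI[OF assms(1) _ assms(2,3)])
  fix A B assume "A \<subseteq> K" "B \<subseteq> K" "A \<inter> F = B \<inter> F"
  then show "(A \<in> x \<longleftrightarrow> A \<in> flip K x F \<G>) \<longleftrightarrow> (B \<in> x \<longleftrightarrow> B \<in> flip K x F \<G>)"
    by (auto simp: flip_def)
qed (auto simp: flip_def)

lemma clopen_diff_flipE:
  assumes "(x, y) \<in> clopen_diff K"
  obtains F \<G> where "finite F" "F \<subseteq> K" "\<G> \<subseteq> Pow F" "y = flip K x F \<G>"
proof -
  obtain F where y: "x \<subseteq> Pow K" "y \<subseteq> Pow K" and F: "finite F" "F \<subseteq> K"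
      "\<And>A B. \<lbrakk>A \<subseteq> K; B \<subseteq> K; A \<inter> F = B \<inter> F\<rbrakk> \<Longrightarrow>
        (A \<in> x \<longleftrightarrow> A \<in> y) \<longleftrightarrow> (B \<in> x \<longleftrightarrow> B \<in> y)"
    using assms by (rule clopen_diffE) (rule that)
  let ?G = "{G \<in> Pow F. (G \<in> x) \<noteq> (G \<in> y)}"
  have "A \<in> y \<longleftrightarrow> A \<in> flip K x F ?G" for A
  proof (cases "A \<subseteq> K")
    case True
    \<comment> \<open>\<open>A\<close> and \<open>A \<inter> F\<close> have the same trace on
      \<open>F\<close>, so the difference is determined by its values on subsets of
      \<open>F\<close>.\<close>
    then have "(A \<in> x \<longleftrightarrow> A \<in> y) \<longleftrightarrow> (A \<inter> F \<in> x \<longleftrightarrow> A \<inter> F \<in> y)"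
      using F by (intro F(3)) auto
    then show ?thesis
      using True by (auto simp: flip_def)
  qed (use y in \<open>auto simp: flip_def\<close>)
  then show thesis
    using that[of F ?G] F by blast
qed

text \<open>Finitely many points of \<open>2^K\<close> are told apart by finitely many coordinates:
  pick one for each pair.\<close>

lemma finite_trace_inj:
  assumes "finite \<Q>" "\<Q> \<subseteq> Pow K"
  obtains F where "finite F" "F \<subseteq> K" "inj_on (\<lambda>A. A \<inter> F) \<Q>"
proof -
  have "\<forall>A\<in>\<Q>. \<forall>B\<in>\<Q>. \<exists>k. A \<noteq> B \<longrightarrow> k \<in> K \<and> (k \<in> A \<longleftrightarrow> k \<notin> B)"
    using assms(2) by blast
  then obtain k where k: "\<And>A B. \<lbrakk>A \<in> \<Q>; B \<in> \<Q>; A \<noteq> B\<rbrakk> \<Longrightarrow>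
      k A B \<in> K \<and> (k A B \<in> A \<longleftrightarrow> k A B \<notin> B)"
    by metis
  let ?F = "(\<lambda>(A, B). k A B) ` {(A, B) \<in> \<Q> \<times> \<Q>. A \<noteq> B}"
  have inj: "inj_on (\<lambda>A. A \<inter> ?F) \<Q>"
  proof (rule inj_onI, rule ccontr)
    fix A B assume AB: "A \<in> \<Q>" "B \<in> \<Q>" "A \<inter> ?F = B \<inter> ?F" "A \<noteq> B"
    then have "k A B \<in> ?F"
      by force
    then have "k A B \<in> A \<longleftrightarrow> k A B \<in> B"
      using AB(3) by (metis (no_types, lifting) IntE IntI)
    then show False
      using k[OF AB(1,2,4)] by simp
  qed
  have "finite {(A, B) \<in> \<Q> \<times> \<Q>. A \<noteq> B}"
    by (rule finite_subset[of _ "\<Q> \<times> \<Q>"]) (use assms in auto)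
  then have fin: "finite ?F"
    by (rule finite_imageI)
  have "?F \<subseteq> K"
    using k by auto
  from that[OF fin this inj] show thesis .
qed

lemma clopen_diff_class_dense:
  assumes x: "x \<subseteq> Pow K" and U: "U \<in> cylinders (Pow K)"
  shows "clopen_diff K `` {x} \<inter> U \<noteq> {}"
proof -
  obtain P N where PN: "U = cylinder (Pow K) P N" "finite P" "finite N"
      "P \<subseteq> Pow K" "N \<subseteq> Pow K" "P \<inter> N = {}"
    using U by (auto simp: cylinders_def)
  have "finite (P \<union> N)" "P \<union> N \<subseteq> Pow K"
    using PN by auto
  then obtain F where F: "finite F" "F \<subseteq> K" "inj_on (\<lambda>A. A \<inter> F) (P \<union> N)"
    by (rule finite_trace_inj)
  \<comment> \<open>These are the traces of the points of \<open>P \<union> N\<close> at which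
    \<open>x\<close> has the wrong value. As traces are injective there, flipping corrects exactly
    those points.\<close>
  define \<G> where "\<G> = (\<lambda>A. A \<inter> F) ` {A \<in> P \<union> N. (A \<in> P) \<noteq> (A \<in> x)}"
  have "A \<in> flip K x F \<G> \<longleftrightarrow> A \<in> P" if A: "A \<in> P \<union> N" for A
  proof -
    have "A \<inter> F \<in> \<G> \<longleftrightarrow> A \<in> {A \<in> P \<union> N. (A \<in> P) \<noteq> (A \<in> x)}"
      unfolding \<G>_def by (rule inj_on_image_mem_iff[OF F(3) A]) auto
    moreover have "A \<subseteq> K"
      using A PN by auto
    ultimately show ?thesis
      using A by (auto simp: flip_def)
  qed
  then have "P \<subseteq> flip K x F \<G>" "flip K x F \<G> \<inter> N = {}"
    using PN(6) by auto
  moreover have "flip K x F \<G> \<subseteq> Pow K"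
    by (auto simp: flip_def)
  ultimately have "flip K x F \<G> \<in> U"
    unfolding PN(1) cylinder_def by blast
  then show ?thesis
    using flip_clopen_diff[OF x F(1,2)] by blast
qed

section \<open>Size and number of the cosets\<close>

lemma card_of_finite_subsets:
  assumes "infinite A"
  shows "|{F. F \<subseteq> A \<and> finite F}| \<le>o |A|"
proof -
  have "|{F. F \<subseteq> A \<and> finite F \<and> card F = n}| \<le>o |A|" (is "|?S n| \<le>o _") for n
  proof (induction n)
    case 0
    have "?S 0 = {{}}"
      by auto
    then show ?case
      using assms by (metis card_of_singl_ordLeq finite.emptyI)
  next
    case (Suc n)
    have "?S (Suc n) \<subseteq> (\<lambda>(a, F). insert a F) ` (A \<times> ?S n)"
    proof
      fix F assume F: "F \<in> ?S (Suc n)"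
      then obtain a G where "F = insert a G" "a \<notin> G" "card G = n" "finite G"
        by (auto simp: card_Suc_eq_finite)
      then show "F \<in> (\<lambda>(a, F). insert a F) ` (A \<times> ?S n)"
        using F by force
    qed
    then have "|?S (Suc n)| \<le>o |A \<times> ?S n|"
      by (meson card_of_image card_of_mono1 ordLeq_transitive)
    moreover have "|A \<times> ?S n| \<le>o |A|"
      by (rule card_of_Sigma_ordLeq_infinite[OF assms card_of_mono1[OF order_refl]]) (use Suc in blast)
    ultimately show ?case
      using ordLeq_transitive by blast
  qed
  moreover have "|UNIV :: nat set| \<le>o |A|"
    using assms by (simp add: infinite_iff_card_of_nat)
  ultimately have "|\<Union>n. ?S n| \<le>o |A|"
    using card_of_UNION_ordLeq_infinite[OF assms, of UNIV ?S] by simp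
  moreover have "(\<Union>n. ?S n) = {F. F \<subseteq> A \<and> finite F}"
    by auto
  ultimately show ?thesis
    by simp
qed

text \<open>Each member of the coset has a code made of a finite subset of \<open>K\<close> and a
  finite family of finite subsets, and there are only \<open>|K|\<close> such codes.\<close>

lemma card_clopen_diff_class:
  assumes K: "infinite K"
  shows "|clopen_diff K `` {x}| \<le>o |K|"
proof -
  let ?F = "{F. F \<subseteq> K \<and> finite F}"
  let ?G = "{\<G>. \<G> \<subseteq> ?F \<and> finite \<G>}"
  have "infinite ((\<lambda>k. {k}) ` K)"
    using K finite_imageD[of "\<lambda>k. {k}" K] by auto
  then have "infinite ?F"
    by (rule contrapos_nn) (erule rev_finite_subset, auto)
  have F: "|?F| \<le>o |K|"
    using card_of_finite_subsets[OF K] .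
  have "|?G| \<le>o |K|"
    using card_of_finite_subsets[OF \<open>infinite ?F\<close>] F ordLeq_transitive by blast
  then have "|?F \<times> ?G| \<le>o |K|"
    by (intro card_of_Sigma_ordLeq_infinite[OF K F] ballI)
  moreover have "clopen_diff K `` {x} \<subseteq> (\<lambda>(F, \<G>). flip K x F \<G>) ` (?F \<times> ?G)"
  proof
    fix y assume "y \<in> clopen_diff K `` {x}"
    then have "(x, y) \<in> clopen_diff K"
      by simp
    then obtain F \<G> where *: "finite F" "F \<subseteq> K" "\<G> \<subseteq> Pow F" "y = flip K x F \<G>"
      by (rule clopen_diff_flipE)
    have "\<G> \<subseteq> ?F"
      using * by (auto intro: finite_subset)
    moreover have "finite \<G>"
      using * by (meson finite_Pow_iff finite_subset)
    ultimately have "F \<in> ?F" "\<G> \<in> ?G"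
      using * by auto
    then show "y \<in> (\<lambda>(F, \<G>). flip K x F \<G>) ` (?F \<times> ?G)"
      using * by force
  qed
  ultimately show ?thesis
    by (meson card_of_image card_of_mono1 ordLeq_transitive)
qed

text \<open>Classes of size at most \<open>|K|\<close> cover a set larger than \<open>|K|\<close>,
  so there are more than \<open>|K|\<close> of them. Their union is then no larger than their
  number.\<close>

lemma card_clopen_diff_classes:
  assumes K: "infinite K"
  shows "|Pow (Pow K)| \<le>o |Pow (Pow K) // clopen_diff K|"
proof -
  let ?Q = "Pow (Pow K) // clopen_diff K"
  have small: "|c| \<le>o |K|" if "c \<in> ?Q" for c
    using that card_clopen_diff_class[OF K] by (auto elim: quotientE)
  have Un: "\<Union>?Q = Pow (Pow K)"
    using Union_quotient[OF equiv_clopen_diff] .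
  have "|K| <o |Pow (Pow K)|"
    using ordLess_transitive[OF card_of_Pow card_of_Pow] .
  then have nle: "\<not> |Pow (Pow K)| \<le>o |K|"
    using not_ordLess_ordLeq[of "|K|" "|Pow (Pow K)|"] by blast
  have "\<not> |?Q| \<le>o |K|"
  proof
    assume "|?Q| \<le>o |K|"
    then have "|\<Union>c\<in>?Q. c| \<le>o |K|"
      by (rule card_of_UNION_ordLeq_infinite[OF K]) (use small in blast)
    with nle show False
      using Un by simp
  qed
  then have le: "|K| \<le>o |?Q|"
    using ordLeq_total[OF card_of_Well_order card_of_Well_order] by blast
  then have "infinite ?Q"
    using K card_of_ordLeq_finite[OF le] by blast
  then have "|\<Union>c\<in>?Q. c| \<le>o |?Q|"
    by (rule card_of_UNION_ordLeq_infinite[OF _ card_of_mono1[OF order_refl]])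
      (use small ordLeq_transitive[OF _ le] in blast)
  then show ?thesis
    using Un by simp
qed

section \<open>Cardinals\<close>

lemma is_card_sup_cong:
  assumes "is_card_sup s C" "s =o t" "Card_order t"
  shows "is_card_sup t C"
  using assms ordLeq_ordIso_trans[OF _ assms(2)]
    ordIso_ordLeq_trans[OF ordIso_symmetric[OF assms(2)]]
  unfolding is_card_sup_def by blast

lemma cards_eq_trans:
  assumes "cards_eq S T" "cards_eq T U"
  shows "cards_eq S U"
  using assms unfolding cards_eq_def by (meson ordIso_transitive)

text \<open>A cardinal up to \<open>s\<close> is isomorphic to an initial segment of
  \<open>s\<close>: a proper one, given by a point, or \<open>Field s\<close> itself. Distinct
  members of \<open>T\<close> need distinct segments.\<close>

lemma card_nonisomorphic_ordLeq:
  fixes s :: "'b rel" and T :: "'c rel set"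
  assumes s: "Cinfinite s" and le: "\<And>r. r \<in> T \<Longrightarrow> r \<le>o s"
    and inj: "\<And>r t. \<lbrakk>r \<in> T; t \<in> T; r =o t\<rbrakk> \<Longrightarrow> r = t"
  shows "|T| \<le>o s"
proof -
  let ?O = "underS s ` Field s \<union> {Field s}"
  have "\<exists>A. A \<in> ?O \<and> r =o Restr s A" if "r \<in> T" for r
  proof (cases "r <o s")
    case True
    then have "Well_order s" "Well_order r"
      unfolding ordLess_def by auto
    then obtain a where "a \<in> Field s" "r =o Restr s (underS s a)"
      using ordLess_iff_ordIso_Restr[of s r] True by blast
    then show ?thesis
      by blast
  next
    case False
    then have "r =o s"
      using le[OF that] ordLeq_iff_ordLess_or_ordIso by blast
    then show ?thesis
      by (intro exI[of _ "Field s"]) (simp add: Restr_Field)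
  qed
  then obtain f where f: "\<And>r. r \<in> T \<Longrightarrow> f r \<in> ?O \<and> r =o Restr s (f r)"
    by metis
  have "inj_on f T"
  proof (rule inj_onI)
    fix r t assume *: "r \<in> T" "t \<in> T" "f r = f t"
    then have "r =o Restr s (f r)" "t =o Restr s (f r)"
      using f[of r] f[of t] by auto
    then have "r =o t"
      using ordIso_transitive[OF _ ordIso_symmetric] by blast
    then show "r = t"
      using inj * by blast
  qed
  then have "|T| \<le>o |?O|"
    by (rule card_of_ordLeqI) (use f in blast)
  also have "|?O| \<le>o s"
  proof (rule Un_Cinfinite_bound[OF _ _ s])
    have Field: "|Field s| \<le>o s"
      using s card_of_Field_ordIso ordIso_imp_ordLeq by blast
    show "|underS s ` Field s| \<le>o s"
      using ordLeq_transitive[OF card_of_image Field] .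
    have "Field s \<noteq> {}"
      using s by (auto simp: cinfinite_def)
    then show "|{Field s}| \<le>o s"
      by (rule ordLeq_transitive[OF card_of_singl_ordLeq Field])
  qed
  finally show ?thesis .
qed

lemma ctwo_cexp_ordIso_Pow: "ctwo ^c r =o |Pow (Field r)|"
  unfolding ctwo_def cexp_def Field_card_of
  by (rule ordIso_symmetric[OF card_of_Pow_Func])

lemma ctwo_cexp_cexp_ordLeq_Pow_Pow:
  assumes "Cinfinite r"
  shows "ctwo ^c (ctwo ^c r) \<le>o |Pow (Pow (Field r))|"
proof -
  have "Cinfinite (ctwo ^c r)"
    by (rule Cinfinite_cexp[OF ordLeq_refl[OF Card_order_ctwo] assms])
  then have "ctwo ^c (ctwo ^c r) \<le>o ctwo ^c |Pow (Field r)|"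
    using cexp_mono2_Cnotzero[OF ordIso_imp_ordLeq[OF ctwo_cexp_ordIso_Pow] Card_order_ctwo]
      Cinfinite_Cnotzero by blast
  also have "ctwo ^c |Pow (Field r)| =o |Pow (Pow (Field r))|"
    using ctwo_cexp_ordIso_Pow[of "|Pow (Field r)|"] by (simp add: Field_card_of)
  finally show ?thesis .
qed

text \<open>\<open>S\<close> may contain several well-orders for one cardinal, while counting the
  layers requires one each. Closure survives because suprema matter only up to isomorphism.\<close>

lemma nonisomorphic_representatives:
  fixes S :: "'b rel set"
  assumes "\<forall>r\<in>S. Cinfinite r" and closed: "omega_closed S"
  obtains T where "T \<subseteq> S" "cards_eq S T" "omega_closed T"
    "\<And>r t. \<lbrakk>r \<in> T; t \<in> T; r =o t\<rbrakk> \<Longrightarrow> r = t"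
proof -
  have refl: "r =o r" if "r \<in> S" for r
    using assms(1) that by (auto simp: card_order_on_def intro: ordIso_reflexive)
  \<comment> \<open>The chosen predicate depends only on the isomorphism class of \<open>r\<close>,
    so isomorphic relations receive the same representative.\<close>
  define rep where "rep r = (SOME t. t \<in> S \<and> t =o r)" for r :: "'b rel"
  have rep: "rep r \<in> S" "rep r =o r" if "r \<in> S" for r
    using someI[of "\<lambda>t. t \<in> S \<and> t =o r" r] refl[OF that] that
    by (auto simp: rep_def)
  have rep_cong: "rep r = rep t" if "r =o t" for r t :: "'b rel"
  proof -
    have "u =o r \<longleftrightarrow> u =o t" for u :: "'b rel"
      using that ordIso_transitive[of u] ordIso_symmetric by blast
    then show ?thesis
      by (simp add: rep_def)
  qed
  have sub: "rep ` S \<subseteq> S"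
    using rep by blast
  show thesis
  proof (rule that[OF sub])
    show "cards_eq S (rep ` S)"
      unfolding cards_eq_def using rep ordIso_symmetric by blast
    show "omega_closed (rep ` S)"
      unfolding omega_closed_def
    proof (intro allI impI)
      fix C assume "C \<subseteq> rep ` S" "C \<noteq> {}" "countable C"
      then obtain s where s: "s \<in> S" "is_card_sup s C"
        using closed sub unfolding omega_closed_def by (meson subset_trans)
      then have "is_card_sup (rep s) C"
        using is_card_sup_cong[OF s(2) ordIso_symmetric] rep assms(1) by blast
      then show "\<exists>s\<in>rep ` S. is_card_sup s C"
        using s by blast
    qed
    fix r t assume *: "r \<in> rep ` S" "t \<in> rep ` S" "r =o t"
    then obtain r' t' where "r' \<in> S" "t' \<in> S" "r = rep r'" "t = rep t'"
      by blast
    moreover from this have "rep r = r" "rep t = t"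
      using rep_cong rep by auto
    ultimately show "r = t"
      using rep_cong[OF *(3)] by simp
  qed
qed

section \<open>The double density spectrum\<close>

text \<open>Distinct cosets are assigned to the pairs of a grade \<open>r\<close> and an element of
  \<open>Field r\<close>. A layer is then \<open>r\<close> cosets of size at most
  \<open>|K|\<close>, each of which meets every cylinder.\<close>

lemma cylinders_graded_base:
  fixes K :: "'a set" and T :: "'b rel set" and s :: "'b rel"
  assumes K: "infinite K"
    and T: "T \<noteq> {}" "omega_closed T"
    and T_inf: "\<And>r. r \<in> T \<Longrightarrow> Cinfinite r"
    and T_inj: "\<And>r t. \<lbrakk>r \<in> T; t \<in> T; r =o t\<rbrakk> \<Longrightarrow> r = t"
    and lower: "\<And>r. r \<in> T \<Longrightarrow> |K| \<le>o r"
    and upper: "\<And>r. r \<in> T \<Longrightarrow> r \<le>o s"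
    and s: "Cinfinite s" "s \<le>o |Pow (Pow K)|"
  obtains Y where "graded_base (cylinders (Pow K)) T Y"
proof -
  let ?Q = "Pow (Pow K) // clopen_diff K"
  let ?J = "SIGMA r : T. Field r"
  have Field: "|Field r| \<le>o r" if "r \<in> T" for r
    using card_of_Field_ordIso T_inf[OF that] ordIso_imp_ordLeq by blast
  \<comment> \<open>At most \<open>s\<close> grades with at most \<open>s\<close> indices each
    require \<open>s\<close> cosets, and \<open>2^(2^|K|)\<close> are available.\<close>
  have "|?J| \<le>o s"
  proof (rule card_of_Sigma_ordLeq_infinite_Field)
    show "infinite (Field s)" "Card_order s"
      using s by (auto simp: cinfinite_def)
    show "|T| \<le>o s"
      using card_nonisomorphic_ordLeq[OF s(1) upper T_inj] .
    show "\<forall>r\<in>T. |Field r| \<le>o s"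
      using ordLeq_transitive[OF Field upper] by blast
  qed
  also note s(2)
  also note card_clopen_diff_classes[OF K]
  finally obtain h where h: "inj_on h ?J" "h ` ?J \<subseteq> ?Q"
    unfolding card_of_ordLeq[symmetric] by blast
  have hQ: "h (r, i) \<in> ?Q" if "r \<in> T" "i \<in> Field r" for r i
    using h(2) that by blast
  have disj: "h (r, i) \<inter> h (t, j) = {}"
    if "r \<in> T" "i \<in> Field r" "t \<in> T" "j \<in> Field t" "(r, i) \<noteq> (t, j)" for r i t j
  proof -
    have "h (r, i) \<noteq> h (t, j)"
      using inj_onD[OF h(1), of "(r, i)" "(t, j)"] that by blast
    then show ?thesis
      using quotient_disj[OF equiv_clopen_diff hQ hQ] that by blast
  qed
  define Y where "Y r = (\<Union>i\<in>Field r. h (r, i))" for r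
  have Y_sub: "\<Union>(Y ` T) \<subseteq> Pow (Pow K)"
    using hQ in_quotient_imp_subset[OF equiv_clopen_diff] unfolding Y_def by blast
  have "graded_base (cylinders (Pow K)) T Y"
  proof
    show "U \<inter> V \<in> cylinders (Pow K)"
      if "U \<in> cylinders (Pow K)" "V \<in> cylinders (Pow K)" "U \<inter> V \<noteq> {}" for U V
      using Int_cylinders[OF that] .
    show "countable \<V>" if "\<V> \<subseteq> cylinders (Pow K)" "pairwise disjnt \<V>" for \<V>
      using countable_disjoint_cylinders[OF that] .
    show "cylinders (Pow K) \<noteq> {}"
      using Pow_in_cylinders by blast
    show "|Y r| \<le>o r" if r: "r \<in> T" for r
      unfolding Y_def
    proof (rule UNION_Cinfinite_bound[OF Field[OF r] _ T_inf[OF r]], rule ballI)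
      fix i assume "i \<in> Field r"
      then obtain x where "h (r, i) = clopen_diff K `` {x}"
        using hQ[OF r] by (metis quotientE)
      then show "|h (r, i)| \<le>o r"
        using ordLeq_transitive[OF card_clopen_diff_class[OF K] lower[OF r]] by simp
    qed
    show "r \<le>o |Y r \<inter> U|" if r: "r \<in> T" and U: "U \<in> cylinders (Pow K)" for r U
    proof -
      have "\<exists>x. x \<in> h (r, i) \<inter> U" if i: "i \<in> Field r" for i
      proof -
        obtain x where "x \<in> Pow (Pow K)" "h (r, i) = clopen_diff K `` {x}"
          using hQ[OF r i] by (rule quotientE)
        then show ?thesis
          using clopen_diff_class_dense[OF _ U, of x] by auto
      qed
      \<comment> \<open>One point of \<open>U\<close> is picked from each coset of the layer;
        disjointness of the cosets makes the choice injective.\<close>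
      then obtain g where g: "\<And>i. i \<in> Field r \<Longrightarrow> g i \<in> h (r, i) \<inter> U"
        by metis
      have "inj_on g (Field r)"
      proof (rule inj_onI, rule ccontr)
        fix i j assume *: "i \<in> Field r" "j \<in> Field r" "g i = g j" "i \<noteq> j"
        then have "g i \<in> h (r, i) \<inter> h (r, j)"
          using g[OF *(1)] g[OF *(2)] by simp
        then show False
          using disj[OF r *(1) r *(2)] *(4) by simp
      qed
      then have "|Field r| \<le>o |Y r \<inter> U|"
        by (rule card_of_ordLeqI) (use g in \<open>auto simp: Y_def\<close>)
      then show ?thesis
        using ordIso_ordLeq_trans[OF ordIso_symmetric[OF card_of_Field_ordIso]] T_inf[OF r]
        by blast
    qed
    show "Y r \<inter> Y t = {}" if "r \<in> T" "t \<in> T" "r \<noteq> t" for r t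
      using disj[OF that(1) _ that(2)] that(3) by (auto simp: Y_def)
    show "\<exists>U\<in>cylinders (Pow K). \<exists>V\<in>cylinders (Pow K). x \<in> U \<and> y \<in> V \<and> U \<inter> V = {}"
      if "x \<in> \<Union>(Y ` T)" "y \<in> \<Union>(Y ` T)" "x \<noteq> y" for x y
    proof -
      have "x \<subseteq> Pow K" "y \<subseteq> Pow K"
        using subsetD[OF Y_sub that(1)] subsetD[OF Y_sub that(2)] by simp_all
      then show ?thesis
        using that(3) by (rule cylinders_separate)
    qed
    show "\<Union>(Y ` T) \<subseteq> \<Union>(cylinders (Pow K))"
      using subset_trans[OF Y_sub Union_upper[OF Pow_in_cylinders]] .
    show "T \<noteq> {}" "omega_closed T"
      using T .
    show "Cinfinite r" if "r \<in> T" for r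
      using T_inf[OF that] .
  qed
  then show thesis
    by (rule that)
qed

theorem theorem2p2:
  fixes S :: "'b rel set" and \<kappa> \<sigma> :: "'b rel"
  assumes "S \<noteq> {}"
    and "\<forall>r\<in>S. Cinfinite r"
    and "omega_closed S"
    and "is_card_min \<kappa> S"
    and "is_card_sup \<sigma> S"
    and "\<sigma> \<le>o ctwo ^c (ctwo ^c \<kappa>)"
  shows "\<exists>X :: 'b set set topology.
           crowded_space X \<and> Hausdorff_space X \<and> cards_eq S (double_density_spectrum X)"
proof -
  have \<kappa>: "\<kappa> \<in> S" "\<And>r. r \<in> S \<Longrightarrow> \<kappa> \<le>o r" "Cinfinite \<kappa>"
    using assms(2,4) by (auto simp: is_card_min_def)
  have \<sigma>: "Card_order \<sigma>" "\<And>r. r \<in> S \<Longrightarrow> r \<le>o \<sigma>"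
    using assms(5) by (auto simp: is_card_sup_def)
  \<comment> \<open>The layers are indexed by representatives; \<open>cards_eq\<close> then carries
    the spectrum back to \<open>S\<close>.\<close>
  obtain T where T: "T \<subseteq> S" "cards_eq S T" "omega_closed T"
      and T_inj: "\<And>r t. \<lbrakk>r \<in> T; t \<in> T; r =o t\<rbrakk> \<Longrightarrow> r = t"
    by (rule nonisomorphic_representatives[OF assms(2,3)]) (rule that)
  have inf: "infinite (Field \<kappa>)"
    using \<kappa>(3) by (simp add: cinfinite_def)
  have ne: "T \<noteq> {}"
    using T(2) assms(1) by (auto simp: cards_eq_def)
  have T_inf: "Cinfinite r" if "r \<in> T" for r
    using assms(2) T(1) that by blast
  have lower: "|Field \<kappa>| \<le>o r" if "r \<in> T" for r
    using ordIso_ordLeq_trans[OF card_of_Field_ordIso \<kappa>(2)] \<kappa>(3) subsetD[OF T(1) that] by simp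
  have upper: "r \<le>o \<sigma>" if "r \<in> T" for r
    using \<sigma>(2) T(1) that by blast
  have \<sigma>_inf: "Cinfinite \<sigma>"
    using cinfinite_mono[OF \<sigma>(2)[OF \<kappa>(1)]] \<kappa>(3) \<sigma>(1) by blast
  have \<sigma>_le: "\<sigma> \<le>o |Pow (Pow (Field \<kappa>))|"
    using ordLeq_transitive[OF assms(6) ctwo_cexp_cexp_ordLeq_Pow_Pow[OF \<kappa>(3)]] .
  obtain Y where "graded_base (cylinders (Pow (Field \<kappa>))) T Y"
    using cylinders_graded_base[OF inf ne T(3) T_inf T_inj lower upper \<sigma>_inf \<sigma>_le] .
  then interpret graded_base "cylinders (Pow (Field \<kappa>))" T Y .
  have "cards_eq S (double_density_spectrum graded_topology)"
    using cards_eq_trans[OF T(2) spectrum_graded_topology] .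
  then show ?thesis
    using crowded_graded_topology Hausdorff_graded_topology by blast
qed

end
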